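(* Let $n\in\mathbb{N}$ and let $f:\mathbb{R}^n\to\mathbb{R}$ be twice differentiable. Let $(x_k),(d_k),(\delta_k),(r_k),(\varepsilon_k)$ be any sequences generated by Algorithm CAT (defined in the context). Suppose that $\nabla^2f$ is locally Lipschitz continuous and that $\sigma>0$. Then $\lim_{k\to\infty}\varepsilon_k=0$ or $\lim_{k\to\infty}f(x_k)=-\infty$.
   Context: $\mathbb{N}=\{1,2,\dots\}$; $\|\cdot\|$ is the Euclidean norm for vectors and the spectral norm for matrices. Algorithm CAT. Parameters: $\theta\in(0,1)$, $\beta\in(0,1)$, $\sigma\in[0,\beta]$, $\omega_1\in(1,\infty)$, $\omega_2\in[\omega_1,\infty)$, $\gamma_2\in(1/\omega_1,1]$, $\gamma_3\in(0,1]$, $0\le\gamma_1<\frac12\big(1-\frac{\beta\theta}{\gamma_3(1-\beta)}\big)$, and $\xi\in(0,\infty)$. Inputs: $r_1\in(0,\infty)$, $x_1\in\mathbb{R}^n$. For each $k\in\mathbb{N}$, let $M_k(d):=\frac12 d^\top\nabla^2 f(x_k)d+\nabla f(x_k)^\top d$. At iteration $k$ the algorithm obtains a direction $d_k\in\mathbb{R}^n$ and a scalar $\delta_k\in[0,\infty)$ (any such pair is allowed) satisfying (1) $\|\nabla M_k(d_k)+\delta_kd_k\|\le\gamma_1\varepsilon_k$; (2) $\gamma_2\delta_kr_k\le\delta_k\|d_k\|$; (3) $\|d_k\|\le r_k$; (4) $M_k(d_k)\le-\gamma_3\frac{\delta_k}{2}\|d_k\|^2$. Here $\varepsilon_1:=\|\nabla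 f(x_1)\|$, and for $k\ge1$, $\varepsilon_{k+1}:=\min\{\varepsilon_k,\|\nabla f(x_k+d_k)\|\}$ if $f(x_k+d_k)\le f(x_k)+b_k$, and $\varepsilon_{k+1}:=\varepsilon_k$ otherwise, where $b_k\in(0,\infty]$ is any sequence with $b_k\ge\xi\varepsilon_k\|d_k\|$ for all $k$. Define $$\hat\rho_k:=\frac{f(x_k)-f(x_k+d_k)}{-M_k(d_k)+\frac{\theta}{2}\min\{\|\nabla f(x_k)\|,\|\nabla f(x_k+d_k)\|\}\|d_k\|}$$ (with $\hat\rho_k:=0$ if the denominator is $0$). Updates: $x_{k+1}:=x_k+d_k$ if $f(x_k+d_k)\le f(x_k)$ and $\hat\rho_k\ge\sigma$ (step accepted), and $x_{k+1}:=x_k$ otherwise (step rejected). $r_{k+1}:=\max\{\omega_2\|d_k\|,r_k\}$ if $\hat\rho_k\ge\beta$, and $r_{k+1}:=r_k/\omega_1$ if $\hat\rho_k<\beta$. *)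

theory Defs
  imports "HOL-Analysis.Analysis"
begin

definition grad :: "(real ^ 'n \<Rightarrow> real) \<Rightarrow> real ^ 'n \<Rightarrow> real ^ 'n"
  where "grad f x = (THE D. GDERIV f x :> D)"

definition hess :: "(real ^ 'n \<Rightarrow> real) \<Rightarrow> real ^ 'n \<Rightarrow> real ^ 'n ^ 'n"
  where "hess f x = jacobian (grad f) (at x)"

definition twice_differentiable :: "(real ^ 'n \<Rightarrow> real) \<Rightarrow> bool"
  where "twice_differentiable f \<longleftrightarrow>
    (\<forall>x. f differentiable (at x)) \<and> (\<forall>x. grad f differentiable (at x))"

lemma grad_eqI:
  assumes "GDERIV f x :> D"
  shows "grad f x = D"
  unfolding grad_def
proof (rule the_equality)
  fix E
  assume "GDERIV f x :> E"
  with assms have "(\<lambda>h. h \<bullet> D) = (\<lambda>h. h \<bullet> E)"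
    unfolding gderiv_def by (rule has_derivative_unique)
  then show "E = D"
    using vector_eq_ldot[of D E] fun_cong by fastforce
qed (fact assms)

lemma GDERIV_grad:
  fixes f :: "real ^ 'n \<Rightarrow> real"
  assumes "f differentiable (at x)"
  shows "GDERIV f x :> grad f x"
proof -
  obtain f' where f': "(f has_derivative f') (at x)"
    using assms by (auto simp: differentiable_def)
  then have "linear f'"
    by (rule has_derivative_linear)
  have "f' = (\<lambda>h. h \<bullet> adjoint f' 1)"
  proof
    show "f' h = h \<bullet> adjoint f' 1" for h
      using adjoint_works[OF \<open>linear f'\<close>, of h 1] by simp
  qed
  with f' have D: "GDERIV f x :> adjoint f' 1"
    unfolding gderiv_def by simp
  show ?thesis
    unfolding grad_eqI[OF D] by (fact D)
qed

lemma has_derivative_grad: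
  assumes "twice_differentiable f"
  shows "(grad f has_derivative (*v) (hess f x)) (at x)"
  using assms by (simp add: twice_differentiable_def hess_def jacobian_works)

definition spectral_norm :: "real ^ 'n ^ 'm \<Rightarrow> real"
  where "spectral_norm A = onorm ((*v) A)"

text \<open>
  The norm of the type of matrices is the Frobenius norm, so the library notion of Lipschitz
  continuity is not used here.
\<close>

definition locally_lipschitz_hess :: "(real ^ 'n \<Rightarrow> real) \<Rightarrow> bool"
  where "locally_lipschitz_hess f \<longleftrightarrow>
    (\<forall>x. \<exists>e>0. \<exists>L\<ge>0. \<forall>y\<in>ball x e. \<forall>z\<in>ball x e.
      spectral_norm (hess f y - hess f z) \<le> L * norm (y - z))"

definition model :: "(real ^ 'n \<Rightarrow> real) \<Rightarrow> real ^ 'n \<Rightarrow> real ^ 'n \<Rightarrow> real"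
  where "model f x d = 1/2 * (d \<bullet> (hess f x *v d)) + grad f x \<bullet> d"

definition rho_hat :: "(real ^ 'n \<Rightarrow> real) \<Rightarrow> real \<Rightarrow> real ^ 'n \<Rightarrow> real ^ 'n \<Rightarrow> real"
  where "rho_hat f \<theta> x d =
    (let q = - model f x d + \<theta>/2 * min (norm (grad f x)) (norm (grad f (x + d))) * norm d
     in if q = 0 then 0 else (f x - f (x + d)) / q)"

definition CAT_params ::
    "real \<Rightarrow> real \<Rightarrow> real \<Rightarrow> real \<Rightarrow> real \<Rightarrow> real \<Rightarrow> real \<Rightarrow> real \<Rightarrow> real \<Rightarrow> bool"
  where "CAT_params \<theta> \<beta> \<sigma> \<omega>\<^sub>1 \<omega>\<^sub>2 \<gamma>\<^sub>1 \<gamma>\<^sub>2 \<gamma>\<^sub>3 \<xi> \<longleftrightarrow>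
    0 < \<theta> \<and> \<theta> < 1 \<and> 0 < \<beta> \<and> \<beta> < 1 \<and> 0 \<le> \<sigma> \<and> \<sigma> \<le> \<beta> \<and>
    1 < \<omega>\<^sub>1 \<and> \<omega>\<^sub>1 \<le> \<omega>\<^sub>2 \<and>
    1 / \<omega>\<^sub>1 < \<gamma>\<^sub>2 \<and> \<gamma>\<^sub>2 \<le> 1 \<and> 0 < \<gamma>\<^sub>3 \<and> \<gamma>\<^sub>3 \<le> 1 \<and>
    0 \<le> \<gamma>\<^sub>1 \<and> \<gamma>\<^sub>1 < 1/2 * (1 - \<beta> * \<theta> / (\<gamma>\<^sub>3 * (1 - \<beta>))) \<and>
    0 < \<xi>"

text \<open>
  Iterations are numbered from 1; index 0 of the sequences is unconstrained. The slack
  sequence \<open>b\<close> may take the value \<open>\<infinity>\<close>.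
\<close>

definition CAT_run ::
    "(real ^ 'n \<Rightarrow> real) \<Rightarrow>
     real \<Rightarrow> real \<Rightarrow> real \<Rightarrow> real \<Rightarrow> real \<Rightarrow> real \<Rightarrow> real \<Rightarrow> real \<Rightarrow> real \<Rightarrow>
     (nat \<Rightarrow> ereal) \<Rightarrow> (nat \<Rightarrow> real ^ 'n) \<Rightarrow> (nat \<Rightarrow> real ^ 'n) \<Rightarrow>
     (nat \<Rightarrow> real) \<Rightarrow> (nat \<Rightarrow> real) \<Rightarrow> (nat \<Rightarrow> real) \<Rightarrow> bool"
  where "CAT_run f \<theta> \<beta> \<sigma> \<omega>\<^sub>1 \<omega>\<^sub>2 \<gamma>\<^sub>1 \<gamma>\<^sub>2 \<gamma>\<^sub>3 \<xi> b x d \<delta> r \<epsilon> \<longleftrightarrow>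
    r 1 > 0 \<and>
    \<epsilon> 1 = norm (grad f (x 1)) \<and>
    (\<forall>k\<ge>1.
      \<delta> k \<ge> 0 \<and>
      norm (grad (model f (x k)) (d k) + \<delta> k *\<^sub>R d k) \<le> \<gamma>\<^sub>1 * \<epsilon> k \<and>
      \<gamma>\<^sub>2 * \<delta> k * r k \<le> \<delta> k * norm (d k) \<and>
      norm (d k) \<le> r k \<and>
      model f (x k) (d k) \<le> - (\<gamma>\<^sub>3 * (\<delta> k / 2) * (norm (d k))\<^sup>2) \<and>
      b k > 0 \<and> b k \<ge> ereal (\<xi> * \<epsilon> k * norm (d k)) \<and>
      \<epsilon> (k + 1) =
        (if ereal (f (x k + d k)) \<le> ereal (f (x k)) + b k
         then min (\<epsilon> k) (norm (grad f (x k + d k))) else \<epsilon> k) \<and>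
      x (k + 1) =
        (if f (x k + d k) \<le> f (x k) \<and> rho_hat f \<theta> (x k) (d k) \<ge> \<sigma>
         then x k + d k else x k) \<and>
      r (k + 1) =
        (if rho_hat f \<theta> (x k) (d k) \<ge> \<beta>
         then max (\<omega>\<^sub>2 * norm (d k)) (r k) else r k / \<omega>\<^sub>1))"

end

theory Submission
  imports Defs
begin

text \<open>
  Suppose that \<open>\<epsilon>\<close> stays above some \<open>e > 0\<close> and that \<open>f (x k)\<close> is bounded below. Every accepted step
  decreases \<open>f\<close> by at least a multiple of its length, so \<open>x\<close> converges to a point \<open>z\<close>. Near \<open>z\<close> the
  Hessian is bounded and the gradient almost constant, so every sufficiently short step
  satisfies \<open>rho_hat \<ge> \<beta>\<close> and \<open>norm (d k) \<ge> \<gamma>\<^sub>2 * r k\<close>. Radii are therefore only reduced after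
  long steps, and so they stay above a positive constant. But if \<open>rho_hat \<ge> \<beta>\<close> holds infinitely often,
  then \<open>norm (d k) \<ge> \<gamma>\<^sub>2 * r k\<close> contradicts the convergence of \<open>x\<close>, and otherwise the
  radii are eventually divided by \<open>\<omega>\<^sub>1\<close> in each iteration.
\<close>

section \<open>Calculus: the gradient of the model and estimates near a point\<close>

text \<open>A quadratic form sees only the symmetric part of its matrix, so that part, applied to
  \<open>d\<close>, appears in the gradient.\<close>

lemma GDERIV_model:
  fixes f :: "real ^ 'n \<Rightarrow> real"
  shows "GDERIV (model f x) d :>
    (1/2) *\<^sub>R (hess f x *v d + transpose (hess f x) *v d) + grad f x"
proof -
  have "(model f x has_derivative
      (\<lambda>h. 1/2 * (d \<bullet> (hess f x *v h) + h \<bullet> (hess f x *v d)) + grad f x \<bullet> h)) (at d)"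
    unfolding model_def
    by (auto intro!: derivative_eq_intros
        bounded_linear.has_derivative[OF matrix_vector_mul_bounded_linear])
  moreover have "d \<bullet> (hess f x *v h) = h \<bullet> (transpose (hess f x) *v d)" for h
    by (metis dot_lmul_matrix inner_commute transpose_matrix_vector)
  ultimately show ?thesis
    unfolding gderiv_def by (simp add: inner_simps algebra_simps inner_commute)
qed

text \<open>The difference \<open>?u\<close> is the symmetric part of the Hessian applied to
  \<open>d\<close>. In \<open>?u \<bullet> ?u\<close> the transpose moves across the inner product,
  so the bound on the Hessian itself suffices, and one factor \<open>norm ?u\<close>
  cancels.\<close>

lemma norm_grad_model_diff_le:
  fixes f :: "real ^ 'n \<Rightarrow> real"
  assumes K: "\<And>v. norm (hess f x *v v) \<le> K * norm v"
  shows "norm (grad (model f x) d - grad f x) \<le> K * norm d"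
proof -
  let ?u = "grad (model f x) d - grad f x"
  have u: "?u = (1/2) *\<^sub>R (hess f x *v d + transpose (hess f x) *v d)"
    by (simp add: grad_eqI[OF GDERIV_model])
  have "?u \<bullet> ?u = 1/2 * (?u \<bullet> (hess f x *v d) + ?u \<bullet> (transpose (hess f x) *v d))"
    by (subst (2) u) (simp only: inner_simps)
  also have "?u \<bullet> (transpose (hess f x) *v d) = d \<bullet> (hess f x *v ?u)"
    by (metis dot_lmul_matrix inner_commute transpose_matrix_vector)
  finally have "?u \<bullet> ?u = 1/2 * (?u \<bullet> (hess f x *v d) + d \<bullet> (hess f x *v ?u))" .
  moreover have "?u \<bullet> (hess f x *v d) \<le> norm ?u * (K * norm d)"
    by (rule order_trans[OF norm_cauchy_schwarz]) (simp add: K mult_left_mono)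
  moreover have "d \<bullet> (hess f x *v ?u) \<le> norm d * (K * norm ?u)"
    by (rule order_trans[OF norm_cauchy_schwarz]) (simp add: K mult_left_mono)
  ultimately have "norm ?u * norm ?u \<le> norm ?u * (K * norm d)"
    by (simp add: dot_square_norm power2_eq_square algebra_simps)
  moreover have "0 \<le> K * norm d"
    using K[of d] norm_ge_zero order_trans by blast
  ultimately show ?thesis
    by (cases "norm ?u = 0") (auto simp: mult_le_cancel_left)
qed

text \<open>On a ball of radius \<open>e\<close> where the Hessian is \<open>L\<close>-Lipschitz it
  differs from its value at the centre by at most \<open>L * e\<close> in spectral norm.\<close>

lemma hess_bounded_near:
  fixes f :: "real ^ 'n \<Rightarrow> real"
  assumes "locally_lipschitz_hess f"
  obtains e K where "e > 0" "K \<ge> 0"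
    "\<And>y v. y \<in> ball z e \<Longrightarrow> norm (hess f y *v v) \<le> K * norm v"
proof -
  obtain e L where e: "e > 0" "L \<ge> 0"
    and L: "\<And>y w. y \<in> ball z e \<Longrightarrow> w \<in> ball z e \<Longrightarrow>
      spectral_norm (hess f y - hess f w) \<le> L * norm (y - w)"
    using assms unfolding locally_lipschitz_hess_def by meson
  define K where "K = L * e + spectral_norm (hess f z)"
  have on: "norm (A *v v) \<le> spectral_norm A * norm v" for A :: "real ^ 'n ^ 'n" and v
    unfolding spectral_norm_def by (rule onorm[OF matrix_vector_mul_bounded_linear])
  have "K \<ge> 0"
    using e by (simp add: K_def spectral_norm_def onorm_pos_le[OF matrix_vector_mul_bounded_linear])
  moreover have "norm (hess f y *v v) \<le> K * norm v" if y: "y \<in> ball z e" for y v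
  proof -
    have "spectral_norm (hess f y - hess f z) \<le> L * norm (y - z)"
      using L y e by simp
    also have "\<dots> \<le> L * e"
      using y e by (intro mult_left_mono) (auto simp: dist_norm norm_minus_commute)
    finally have "spectral_norm (hess f y - hess f z) \<le> L * e" .
    then have "norm ((hess f y - hess f z) *v v) \<le> L * e * norm v"
      by (intro order_trans[OF on] mult_right_mono) auto
    moreover have "hess f y *v v = (hess f y - hess f z) *v v + hess f z *v v"
      by (simp add: matrix_vector_mult_diff_rdistrib)
    ultimately show ?thesis
      using on[of "hess f z" v] norm_triangle_ineq[of "(hess f y - hess f z) *v v" "hess f z *v v"]
      by (simp add: K_def distrib_right)
  qed
  ultimately show thesis
    using that e by blast
qed

text \<open>The gradient is continuous at \<open>z\<close>, hence nearly constant on a small ball,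
  and the mean value inequality controls the remainder there.\<close>

lemma first_order_remainder_near:
  fixes f :: "real ^ 'n \<Rightarrow> real"
  assumes "twice_differentiable f" and "\<eta> > 0"
  obtains e where "e > 0"
    "\<And>y h. y \<in> ball z e \<Longrightarrow> y + h \<in> ball z e \<Longrightarrow>
      f (y + h) - f y \<le> grad f y \<bullet> h + \<eta> * norm h"
proof -
  have "isCont (grad f) z"
    using assms by (simp add: twice_differentiable_def differentiable_imp_continuous_within)
  then obtain e where e: "e > 0" and
    ec: "\<And>y. dist y z < e \<Longrightarrow> dist (grad f y) (grad f z) < \<eta> / 2"
    using assms(2) unfolding continuous_at_eps_delta by (metis half_gt_zero)
  have "f (y + h) - f y \<le> grad f y \<bullet> h + \<eta> * norm h"
    if y: "y \<in> ball z e" and yh: "y + h \<in> ball z e" for y h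
  proof -
    \<comment> \<open>Subtracting the linear part at \<open>y\<close> leaves the derivative
      \<open>grad f u - grad f y\<close>; both gradients are within \<open>\<eta> / 2\<close> of the
      one at \<open>z\<close>.\<close>
    let ?\<phi> = "\<lambda>u. f u - grad f y \<bullet> u"
    have "norm (?\<phi> (y + h) - ?\<phi> y) \<le> \<eta> * norm (y + h - y)"
    proof (rule differentiable_bound[where S = "ball z e" and f' = "\<lambda>u v. (grad f u - grad f y) \<bullet> v"])
      fix u
      assume u: "u \<in> ball z e"
      have "(f has_derivative (\<lambda>v. v \<bullet> grad f u)) (at u)"
        using GDERIV_grad[of f u] assms(1) by (simp add: twice_differentiable_def gderiv_def)
      then have "(?\<phi> has_derivative (\<lambda>v. v \<bullet> grad f u - grad f y \<bullet> v)) (at u)"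
        by (auto intro!: derivative_eq_intros)
      then show "(?\<phi> has_derivative (\<lambda>v. (grad f u - grad f y) \<bullet> v)) (at u within ball z e)"
        by (simp add: inner_diff_left inner_commute[of _ "grad f u"] has_derivative_at_withinI)
      have "norm (grad f u - grad f y) \<le> \<eta>"
        using ec[of u] ec[of y] u y dist_triangle_half_r[of "grad f z" "grad f u" \<eta> "grad f y"]
        by (simp add: dist_commute dist_norm[symmetric])
      then show "onorm (\<lambda>v. (grad f u - grad f y) \<bullet> v) \<le> \<eta>"
        unfolding real_norm_def[symmetric]
        by (intro onorm_le order_trans[OF Cauchy_Schwarz_ineq2[folded real_norm_def]] mult_right_mono)
          auto
    qed (use y yh in auto)
    then show ?thesis
      by (simp add: inner_add_right)
  qed
  then show thesis
    using that e by blast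
qed

section \<open>Sequences whose steps are bounded by a telescoping sum\<close>

lemma norm_diff_le_telescope:
  fixes X :: "nat \<Rightarrow> 'a::real_normed_vector" and F :: "nat \<Rightarrow> real"
  assumes "\<And>k. norm (X (Suc k) - X k) \<le> F k - F (Suc k)" and "m \<le> n"
  shows "norm (X n - X m) \<le> F m - F n"
  using assms(2)
proof (induction n rule: dec_induct)
  case (step n)
  then show ?case
    using assms(1)[of n] norm_triangle_ineq[of "X (Suc n) - X n" "X n - X m"] by simp
qed simp

text \<open>The bound forces \<open>F\<close> to decrease, so \<open>F\<close> converges and is
  Cauchy; distances in \<open>X\<close> are dominated by differences of \<open>F\<close>.\<close>

lemma convergent_of_telescoping_bound:
  fixes X :: "nat \<Rightarrow> 'a::banach" and F :: "nat \<Rightarrow> real"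
  assumes step: "\<And>k. norm (X (Suc k) - X k) \<le> F k - F (Suc k)" and "\<And>k. B \<le> F k"
  shows "convergent X"
proof -
  have "decseq F"
    by (intro decseq_SucI) (metis step diff_ge_0_iff_ge norm_ge_zero order_trans)
  then obtain L where "F \<longlonglongrightarrow> L"
    using decseq_convergent assms(2) by metis
  then have "Cauchy F"
    by (rule LIMSEQ_imp_Cauchy)
  have "Cauchy X"
  proof (rule CauchyI')
    fix e :: real
    assume "e > 0"
    then obtain M where M: "\<And>m n. m \<ge> M \<Longrightarrow> n \<ge> M \<Longrightarrow> norm (F m - F n) < e"
      using \<open>Cauchy F\<close> CauchyD by blast
    have "dist (X m) (X n) < e" if "m \<ge> M" "n > m" for m n
      using norm_diff_le_telescope[of X F m n, OF step] M[of m n] that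
      by (simp add: dist_norm norm_minus_commute)
    then show "\<exists>M. \<forall>m\<ge>M. \<forall>n>m. dist (X m) (X n) < e"
      by blast
  qed
  then show ?thesis
    by (simp add: Cauchy_convergent)
qed

section \<open>One short step away from stationarity\<close>

text \<open>The optimality condition makes \<open>\<delta> * norm d\<close> at least
  \<open>(1 - \<gamma>\<^sub>1) * norm (grad f x) - K * norm d\<close>, so the model decrease is of
  first order in \<open>norm d\<close>. Model and actual decrease differ by at most
  \<open>norm d * (K * norm d / 2 + \<eta>)\<close>, which \<open>small\<close> makes
  affordable.\<close>

lemma short_step_successful:
  fixes f :: "real ^ 'n \<Rightarrow> real"
  assumes par: "CAT_params \<theta> \<beta> \<sigma> \<omega>\<^sub>1 \<omega>\<^sub>2 \<gamma>\<^sub>1 \<gamma>\<^sub>2 \<gamma>\<^sub>3 \<xi>"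
    and opt: "norm (grad (model f x) d + \<delta> *\<^sub>R d) \<le> \<gamma>\<^sub>1 * \<epsilon>"
    and rad: "\<gamma>\<^sub>2 * \<delta> * r \<le> \<delta> * norm d"
    and mod: "model f x d \<le> - (\<gamma>\<^sub>3 * (\<delta> / 2) * (norm d)\<^sup>2)"
    and "\<delta> \<ge> 0" "\<epsilon> \<le> norm (grad f x)" "0 < e" "e \<le> norm (grad f x)"
    and K: "\<And>v. norm (hess f x *v v) \<le> K * norm v"
    and tay: "f (x + d) - f x \<le> grad f x \<bullet> d + \<eta> * norm d" and "\<eta> > 0"
    and small: "2 * K * norm d + 2 * \<eta> \<le> (\<gamma>\<^sub>3 * (1 - \<beta>) * (1 - \<gamma>\<^sub>1) - \<beta> * \<theta>) * e"
  shows "rho_hat f \<theta> x d \<ge> \<beta>" and "\<gamma>\<^sub>2 * r \<le> norm d"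
proof -
  let ?g = "norm (grad f x)" and ?M = "model f x d"
  define c where "c = \<gamma>\<^sub>3 * (1 - \<beta>) * (1 - \<gamma>\<^sub>1) - \<beta> * \<theta>"
  have p: "0 < \<theta>" "0 < \<beta>" "\<beta> < 1" "0 < \<gamma>\<^sub>3" "\<gamma>\<^sub>3 \<le> 1" "0 \<le> \<gamma>\<^sub>1"
    and \<gamma>\<^sub>1: "2 * \<gamma>\<^sub>1 < 1 - \<beta> * \<theta> / (\<gamma>\<^sub>3 * (1 - \<beta>))"
    using par by (auto simp: CAT_params_def)
  have Kd: "0 \<le> K * norm d"
    using K[of d] norm_ge_zero order_trans by blast
  \<comment> \<open>The left side of \<open>small\<close> is positive because
    \<open>\<eta> > 0\<close>, so \<open>small\<close> itself forces \<open>c\<close> to be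
    positive.\<close>
  have "0 < c * e"
    using small Kd \<open>\<eta> > 0\<close> by (simp add: c_def)
  then have "c > 0"
    using \<open>e > 0\<close> by (simp add: zero_less_mult_iff)
  have "\<gamma>\<^sub>3 * (1 - \<beta>) \<le> 1"
    using p by (simp add: mult_le_one)
  have "0 < \<beta> * \<theta> / (\<gamma>\<^sub>3 * (1 - \<beta>))"
    using p by simp
  then have "\<gamma>\<^sub>1 < 1"
    using \<gamma>\<^sub>1 p by linarith
  have "c \<le> 1 - \<gamma>\<^sub>1"
  proof -
    have "c \<le> \<gamma>\<^sub>3 * (1 - \<beta>) * (1 - \<gamma>\<^sub>1)"
      using p by (simp add: c_def)
    also have "\<dots> \<le> 1 * (1 - \<gamma>\<^sub>1)"
      using \<open>\<gamma>\<^sub>3 * (1 - \<beta>) \<le> 1\<close> \<open>\<gamma>\<^sub>1 < 1\<close> by (intro mult_right_mono) auto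
    finally show ?thesis
      by simp
  qed
  have eg: "c * e \<le> c * ?g"
    using \<open>c > 0\<close> assms by (intro mult_left_mono) auto
  have small': "2 * (K * norm d) + 2 * \<eta> \<le> c * ?g"
    using small eg by (simp add: c_def)
  have "c * ?g \<le> (1 - \<gamma>\<^sub>1) * ?g"
    using \<open>c \<le> 1 - \<gamma>\<^sub>1\<close> by (intro mult_right_mono) auto
  \<comment> \<open>Stated for an arbitrary \<open>w\<close> so that \<open>norm\<close> treats
    \<open>\<delta> *\<^sub>R d\<close> as a single vector.\<close>
  have "?g \<le> norm (grad (model f x) d + w) + norm (grad (model f x) d - grad f x) + norm w" for w
    by norm
  from this[of "\<delta> *\<^sub>R d"]
  have "?g \<le> norm (grad (model f x) d + \<delta> *\<^sub>R d) + norm (grad (model f x) d - grad f x)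
      + \<delta> * norm d"
    using \<open>\<delta> \<ge> 0\<close> by simp
  moreover have "\<gamma>\<^sub>1 * \<epsilon> \<le> \<gamma>\<^sub>1 * ?g"
    using p assms by (intro mult_left_mono) auto
  ultimately have dd: "(1 - \<gamma>\<^sub>1) * ?g - K * norm d \<le> \<delta> * norm d"
    using opt norm_grad_model_diff_le[OF K, of d] by (simp add: algebra_simps)
  have pos: "0 < (1 - \<gamma>\<^sub>1) * ?g - K * norm d"
    using small' \<open>c * ?g \<le> (1 - \<gamma>\<^sub>1) * ?g\<close> \<open>\<eta> > 0\<close> Kd by linarith
  with dd have "0 < \<delta> * norm d"
    by linarith
  then have "\<delta> > 0" "norm d > 0"
    using \<open>\<delta> \<ge> 0\<close> by (auto simp: zero_less_mult_iff)
  \<comment> \<open>Positivity of \<open>\<delta>\<close> allows cancelling it in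
    \<open>rad\<close>.\<close>
  then show "\<gamma>\<^sub>2 * r \<le> norm d"
    using rad by (simp add: mult.commute mult.left_commute mult_le_cancel_left)
  have "\<gamma>\<^sub>3 / 2 * norm d * ((1 - \<gamma>\<^sub>1) * ?g - K * norm d) \<le> \<gamma>\<^sub>3 / 2 * norm d * (\<delta> * norm d)"
    using dd p by (intro mult_left_mono) auto
  then have M: "\<gamma>\<^sub>3 * norm d * ((1 - \<gamma>\<^sub>1) * ?g - K * norm d) \<le> 2 * (- ?M)"
    using mod by (simp add: power2_eq_square algebra_simps)
  moreover have "0 < \<gamma>\<^sub>3 * norm d * ((1 - \<gamma>\<^sub>1) * ?g - K * norm d)"
    using p pos \<open>norm d > 0\<close> by simp
  ultimately have "- ?M > 0"
    by linarith
  define t where "t = min ?g (norm (grad f (x + d)))"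
  have t: "0 \<le> t" "t \<le> ?g"
    by (auto simp: t_def)
  define q where "q = - ?M + \<theta>/2 * t * norm d"
  have "q > 0"
    unfolding q_def using \<open>- ?M > 0\<close> t p by (intro add_pos_nonneg) auto
  \<comment> \<open>The gradient terms of \<open>tay\<close> and of the model coincide, so only the
    curvature term and the remainder separate the two decreases.\<close>
  have "- (d \<bullet> (hess f x *v d)) \<le> norm d * (K * norm d)"
    using norm_cauchy_schwarz[of d "- (hess f x *v d)"] mult_left_mono[OF K[of d], of "norm d"]
    by simp
  then have dec: "2 * (f x - f (x + d)) \<ge> 2 * (- ?M) - norm d * (K * norm d + 2 * \<eta>)"
    using tay by (simp add: model_def algebra_simps)
  \<comment> \<open>The share \<open>1 - \<beta>\<close> of the model decrease must pay for
    curvature, remainder and the gradient term of \<open>q\<close>. One \<open>K * norm d\<close>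
    comes from \<open>M\<close>, the other from \<open>dec\<close>, which explains the
    \<open>2 * K\<close> in \<open>small\<close>.\<close>
  have "(1 - \<beta>) * (\<gamma>\<^sub>3 * norm d * ((1 - \<gamma>\<^sub>1) * ?g - K * norm d)) \<le> (1 - \<beta>) * (2 * (- ?M))"
    using M p by (intro mult_left_mono) auto
  moreover have "(\<gamma>\<^sub>3 * (1 - \<beta>)) * (K * norm d * norm d) \<le> 1 * (K * norm d * norm d)"
    using \<open>\<gamma>\<^sub>3 * (1 - \<beta>) \<le> 1\<close> Kd by (intro mult_right_mono) auto
  moreover have "norm d * (2 * (K * norm d) + 2 * \<eta>) \<le> norm d * (c * ?g)"
    using small' by (intro mult_left_mono) auto
  moreover have "(\<beta> * \<theta> * norm d) * t \<le> (\<beta> * \<theta> * norm d) * ?g"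
    using t p by (intro mult_left_mono) auto
  ultimately have "2 * (- ?M) - norm d * (K * norm d + 2 * \<eta>) \<ge> 2 * (\<beta> * q)"
    unfolding c_def q_def by (simp add: algebra_simps)
  from order_trans[OF this dec] have "\<beta> * q \<le> f x - f (x + d)"
    by simp
  then show "rho_hat f \<theta> x d \<ge> \<beta>"
    using \<open>q > 0\<close> unfolding rho_hat_def Let_def t_def[symmetric] q_def[symmetric]
    by (simp add: pos_le_divide_eq)
qed

section \<open>One-step consequences of the update rules\<close>

locale cat_run =
  fixes f :: "real ^ 'n \<Rightarrow> real"
    and \<theta> \<beta> \<sigma> \<omega>\<^sub>1 \<omega>\<^sub>2 \<gamma>\<^sub>1 \<gamma>\<^sub>2 \<gamma>\<^sub>3 \<xi> :: real
    and b :: "nat \<Rightarrow> ereal"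
    and x d :: "nat \<Rightarrow> real ^ 'n"
    and \<delta> r \<epsilon> :: "nat \<Rightarrow> real"
  assumes twice: "twice_differentiable f"
    and params: "CAT_params \<theta> \<beta> \<sigma> \<omega>\<^sub>1 \<omega>\<^sub>2 \<gamma>\<^sub>1 \<gamma>\<^sub>2 \<gamma>\<^sub>3 \<xi>"
    and run: "CAT_run f \<theta> \<beta> \<sigma> \<omega>\<^sub>1 \<omega>\<^sub>2 \<gamma>\<^sub>1 \<gamma>\<^sub>2 \<gamma>\<^sub>3 \<xi> b x d \<delta> r \<epsilon>"
    and lipschitz: "locally_lipschitz_hess f"
    and \<sigma>_pos: "\<sigma> > 0"
begin

lemma param_bounds:
  "0 < \<theta>" "0 < \<beta>" "\<beta> < 1" "\<sigma> \<le> \<beta>" "1 < \<omega>\<^sub>1" "0 < \<gamma>\<^sub>2" "0 < \<gamma>\<^sub>3"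
proof -
  show "0 < \<theta>" "0 < \<beta>" "\<beta> < 1" "\<sigma> \<le> \<beta>" "1 < \<omega>\<^sub>1" "0 < \<gamma>\<^sub>3"
    using params by (auto simp: CAT_params_def)
  have "0 < 1 / \<omega>\<^sub>1"
    using params by (simp add: CAT_params_def)
  also have "\<dots> < \<gamma>\<^sub>2"
    using params by (simp add: CAT_params_def)
  finally show "0 < \<gamma>\<^sub>2" .
qed

text \<open>As \<open>\<gamma>\<^sub>1 \<ge> 0\<close>, the parameter bound on
  \<open>2 * \<gamma>\<^sub>1\<close> also bounds \<open>\<gamma>\<^sub>1\<close>; multiplying by
  \<open>\<gamma>\<^sub>3 * (1 - \<beta>)\<close> gives the margin used in
  \<open>short_step_successful\<close>.\<close>

lemma success_margin_pos: "0 < \<gamma>\<^sub>3 * (1 - \<beta>) * (1 - \<gamma>\<^sub>1) - \<beta> * \<theta>"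
proof -
  let ?m = "\<gamma>\<^sub>3 * (1 - \<beta>)" and ?c = "\<beta> * \<theta> / (\<gamma>\<^sub>3 * (1 - \<beta>))"
  have "?m > 0"
    using param_bounds by simp
  have "0 \<le> \<gamma>\<^sub>1" "2 * \<gamma>\<^sub>1 < 1 - ?c"
    using params by (auto simp: CAT_params_def)
  then have "0 < 1 - \<gamma>\<^sub>1 - ?c"
    by linarith
  with \<open>?m > 0\<close> have "0 < ?m * (1 - \<gamma>\<^sub>1 - ?c)"
    by (rule mult_pos_pos)
  also have "\<dots> = ?m * (1 - \<gamma>\<^sub>1) - \<beta> * \<theta>"
    using less_imp_neq[OF \<open>?m > 0\<close>]
    by (simp only: right_diff_distrib[of ?m "1 - \<gamma>\<^sub>1"] times_divide_eq_right) simp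
  finally show ?thesis .
qed

context
  fixes k :: nat
  assumes k: "k \<ge> 1"
begin

lemma step_conditions:
  "\<delta> k \<ge> 0"
  "norm (grad (model f (x k)) (d k) + \<delta> k *\<^sub>R d k) \<le> \<gamma>\<^sub>1 * \<epsilon> k"
  "\<gamma>\<^sub>2 * \<delta> k * r k \<le> \<delta> k * norm (d k)"
  "norm (d k) \<le> r k"
  "model f (x k) (d k) \<le> - (\<gamma>\<^sub>3 * (\<delta> k / 2) * (norm (d k))\<^sup>2)"
  "b k > 0"
  using run k unfolding CAT_run_def by auto

lemma \<epsilon>_Suc:
  "\<epsilon> (Suc k) = (if ereal (f (x k + d k)) \<le> ereal (f (x k)) + b k
    then min (\<epsilon> k) (norm (grad f (x k + d k))) else \<epsilon> k)"
  using run k unfolding CAT_run_def by simp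

lemma r_Suc:
  "r (Suc k) = (if rho_hat f \<theta> (x k) (d k) \<ge> \<beta>
    then max (\<omega>\<^sub>2 * norm (d k)) (r k) else r k / \<omega>\<^sub>1)"
  using run k unfolding CAT_run_def by simp

lemma model_nonpos: "model f (x k) (d k) \<le> 0"
proof -
  have "0 \<le> \<gamma>\<^sub>3 * (\<delta> k / 2) * (norm (d k))\<^sup>2"
    using step_conditions(1) param_bounds by simp
  then show ?thesis
    using step_conditions(5) by linarith
qed

text \<open>The model value is nonpositive, so the denominator of \<open>rho_hat\<close> is at least
  its gradient term.\<close>

lemma accepted_decrease:
  assumes "rho_hat f \<theta> (x k) (d k) \<ge> \<sigma>"
  shows "f (x k) - f (x k + d k) \<ge>
    \<sigma> * \<theta> / 2 * min (norm (grad f (x k))) (norm (grad f (x k + d k))) * norm (d k)"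
proof -
  let ?s = "\<theta> / 2 * min (norm (grad f (x k))) (norm (grad f (x k + d k))) * norm (d k)"
  define q where "q = - model f (x k) (d k) + ?s"
  have "0 \<le> ?s"
    using param_bounds by simp
  with model_nonpos have "?s \<le> q" "0 \<le> q"
    unfolding q_def by linarith+
  \<comment> \<open>Since \<open>\<sigma> > 0\<close>, the default value 0 of \<open>rho_hat\<close>
    cannot pass the test.\<close>
  have "q \<noteq> 0" "\<sigma> \<le> (f (x k) - f (x k + d k)) / q"
    using assms \<sigma>_pos unfolding rho_hat_def Let_def q_def[symmetric] by (auto split: if_splits)
  then have "\<sigma> * q \<le> f (x k) - f (x k + d k)"
    using \<open>0 \<le> q\<close> by (simp add: pos_le_divide_eq)
  moreover have "\<sigma> * ?s \<le> \<sigma> * q"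
    using \<open>?s \<le> q\<close> \<sigma>_pos by simp
  ultimately show ?thesis
    by (simp add: mult.assoc)
qed

text \<open>The ratio test already implies that \<open>f\<close> does not increase, so it alone
  decides acceptance.\<close>

lemma x_Suc: "x (Suc k) = (if rho_hat f \<theta> (x k) (d k) \<ge> \<sigma> then x k + d k else x k)"
proof -
  have "f (x k + d k) \<le> f (x k)" if "rho_hat f \<theta> (x k) (d k) \<ge> \<sigma>"
  proof -
    have "0 \<le> \<sigma> * \<theta> / 2 * min (norm (grad f (x k))) (norm (grad f (x k + d k))) * norm (d k)"
      using \<sigma>_pos param_bounds by simp
    then show ?thesis
      using accepted_decrease[OF that] by linarith
  qed
  then show ?thesis
    using run k unfolding CAT_run_def by simp
qed

lemma f_Suc_le: "f (x (Suc k)) \<le> f (x k)"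
  using run k unfolding CAT_run_def by simp

lemma \<epsilon>_Suc_le: "\<epsilon> (Suc k) \<le> \<epsilon> k"
  by (simp add: \<epsilon>_Suc)

end

lemma r_pos: "k \<ge> 1 \<Longrightarrow> r k > 0"
proof (induction k rule: nat_induct_at_least)
  case base
  then show ?case
    using run by (simp add: CAT_run_def)
next
  case (Suc k)
  then show ?case
    using param_bounds by (auto simp: r_Suc less_max_iff_disj)
qed

lemma \<epsilon>_nonneg: "k \<ge> 1 \<Longrightarrow> \<epsilon> k \<ge> 0"
proof (induction k rule: nat_induct_at_least)
  case base
  then show ?case
    using run by (simp add: CAT_run_def)
next
  case (Suc k)
  then show ?case
    by (simp add: \<epsilon>_Suc)
qed

text \<open>An accepted step satisfies the slack test because \<open>b k > 0\<close>, so the new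
  gradient enters the minimum; a rejected step keeps the point while \<open>\<epsilon>\<close>
  cannot grow.\<close>

lemma \<epsilon>_le_norm_grad: "k \<ge> 1 \<Longrightarrow> \<epsilon> k \<le> norm (grad f (x k))"
proof (induction k rule: nat_induct_at_least)
  case base
  then show ?case
    using run by (simp add: CAT_run_def)
next
  case (Suc k)
  show ?case
  proof (cases "rho_hat f \<theta> (x k) (d k) \<ge> \<sigma>")
    case True
    then have X: "x (Suc k) = x k + d k"
      using Suc by (simp add: x_Suc)
    then have "f (x k + d k) \<le> f (x k)"
      using f_Suc_le[of k] Suc by simp
    moreover have "0 < b k"
      using step_conditions(6) Suc by simp
    ultimately have "ereal (f (x k + d k)) \<le> ereal (f (x k)) + b k"
      by (metis add.right_neutral add_mono ereal_less_eq(3) less_imp_le)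
    then show ?thesis
      using Suc X by (simp add: \<epsilon>_Suc)
  next
    case False
    then show ?thesis
      using Suc \<epsilon>_Suc_le[of k] by (simp add: x_Suc)
  qed
qed

section \<open>Runs on which \<open>\<epsilon>\<close> stays above a positive constant\<close>

text \<open>Rejected steps have length 0, and accepted ones pay for their length in
  \<open>f\<close>. The right side has the form \<open>convergent_of_telescoping_bound\<close>
  expects.\<close>

lemma norm_x_diff_le:
  assumes "k \<ge> 1" and "e > 0" and e: "\<And>k. k \<ge> 1 \<Longrightarrow> e \<le> \<epsilon> k"
  shows "norm (x (Suc k) - x k) \<le> 2 / (\<sigma> * \<theta> * e) * f (x k) - 2 / (\<sigma> * \<theta> * e) * f (x (Suc k))"
proof -
  have p: "\<sigma> * \<theta> * e > 0"
    using \<sigma>_pos param_bounds \<open>e > 0\<close> by simp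
  have "\<sigma> * \<theta> * e / 2 * norm (x (Suc k) - x k) \<le> f (x k) - f (x (Suc k))"
  proof (cases "rho_hat f \<theta> (x k) (d k) \<ge> \<sigma>")
    case True
    then have X: "x (Suc k) = x k + d k"
      using assms(1) by (simp add: x_Suc)
    \<comment> \<open>The trial point is the next iterate, so \<open>\<epsilon> (Suc k)\<close>
      bounds its gradient norm from below.\<close>
    have "e \<le> norm (grad f (x k))" "e \<le> norm (grad f (x k + d k))"
      using e[of k] e[of "Suc k"] \<epsilon>_le_norm_grad[of k] \<epsilon>_le_norm_grad[of "Suc k"] assms(1) X
      by auto
    then have "\<sigma> * \<theta> / 2 * e * norm (d k)
        \<le> \<sigma> * \<theta> / 2 * min (norm (grad f (x k))) (norm (grad f (x k + d k))) * norm (d k)"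
      using \<sigma>_pos param_bounds by (intro mult_right_mono mult_left_mono) auto
    then show ?thesis
      using accepted_decrease[OF assms(1) True] by (simp add: X)
  qed (use assms(1) in \<open>simp add: x_Suc\<close>)
  then have "norm (x (Suc k) - x k) \<le> (f (x k) - f (x (Suc k))) / (\<sigma> * \<theta> * e / 2)"
    using p by (subst pos_le_divide_eq) (simp_all add: mult.commute)
  also have "\<dots> = 2 / (\<sigma> * \<theta> * e) * (f (x k) - f (x (Suc k)))"
    by simp
  finally show ?thesis
    by (simp only: right_diff_distrib)
qed

lemma short_steps_near_limit:
  assumes "x \<longlonglongrightarrow> z" and "e > 0" and e: "\<And>k. k \<ge> 1 \<Longrightarrow> e \<le> \<epsilon> k"
  obtains s N where "s > 0" "N \<ge> 1"
    "\<And>k. k \<ge> N \<Longrightarrow> norm (d k) < s \<Longrightarrow>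
      rho_hat f \<theta> (x k) (d k) \<ge> \<beta> \<and> \<gamma>\<^sub>2 * r k \<le> norm (d k)"
proof -
  define c where "c = (\<gamma>\<^sub>3 * (1 - \<beta>) * (1 - \<gamma>\<^sub>1) - \<beta> * \<theta>) * e"
  have "c > 0"
    using success_margin_pos \<open>e > 0\<close> by (simp add: c_def)
  obtain e1 K where e1: "e1 > 0" "K \<ge> 0"
    and K: "\<And>y v. y \<in> ball z e1 \<Longrightarrow> norm (hess f y *v v) \<le> K * norm v"
    using hess_bounded_near[OF lipschitz, of z] by metis
  obtain e2 where e2: "e2 > 0" and
    tay: "\<And>y h. y \<in> ball z e2 \<Longrightarrow> y + h \<in> ball z e2 \<Longrightarrow>
      f (y + h) - f y \<le> grad f y \<bullet> h + c / 4 * norm h"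
    using first_order_remainder_near[OF twice, of "c / 4" z] \<open>c > 0\<close> by auto
  \<comment> \<open>The first entry keeps the trial point in the ball of radius \<open>e2\<close>.
    The second gives \<open>2 * K * norm d \<le> c / 2\<close>, and the remainder
    \<open>2 * (c / 4)\<close> takes the other half of \<open>c\<close>; \<open>K + 1\<close> avoids
    division by zero.\<close>
  define s where "s = min (e2 / 2) (c / (4 * (K + 1)))"
  have s: "s > 0"
    using e1 e2 \<open>c > 0\<close> by (simp add: s_def)
  have "eventually (\<lambda>k. dist (x k) z < min e1 (e2 / 2)) sequentially"
    using e1 e2 by (intro tendstoD[OF assms(1)]) simp
  then obtain N where N: "\<And>k. k \<ge> N \<Longrightarrow> dist (x k) z < min e1 (e2 / 2)"
    by (auto simp: eventually_sequentially)
  have "rho_hat f \<theta> (x k) (d k) \<ge> \<beta> \<and> \<gamma>\<^sub>2 * r k \<le> norm (d k)"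
    if kN: "k \<ge> max 1 N" and dk: "norm (d k) < s" for k
  proof -
    have k: "k \<ge> 1" and x: "dist (x k) z < e1" "dist (x k) z < e2 / 2"
      using kN N[of k] by auto
    have d2: "norm (d k) < e2 / 2" and d3: "norm (d k) \<le> c / (4 * (K + 1))"
      using dk by (auto simp: s_def)
    have "dist (x k + d k) z \<le> dist (x k) z + norm (d k)"
      unfolding dist_norm by norm
    then have t: "f (x k + d k) - f (x k) \<le> grad f (x k) \<bullet> d k + c / 4 * norm (d k)"
      using x d2 e2 by (intro tay) (auto simp: dist_commute)
    have K': "norm (hess f (x k) *v v) \<le> K * norm v" for v
      using K[of "x k"] x by (simp add: dist_commute)
    have "(K + 1) * norm (d k) \<le> (K + 1) * (c / (4 * (K + 1)))"
      using d3 e1 by (intro mult_left_mono) auto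
    also have "\<dots> = c / 4"
      using e1 by (simp add: field_simps)
    finally have "K * norm (d k) + norm (d k) \<le> c / 4"
      by (simp add: algebra_simps)
    then have sm: "2 * K * norm (d k) + 2 * (c / 4)
        \<le> (\<gamma>\<^sub>3 * (1 - \<beta>) * (1 - \<gamma>\<^sub>1) - \<beta> * \<theta>) * e"
      using norm_ge_zero[of "d k"] unfolding c_def[symmetric] by linarith
    have "e \<le> norm (grad f (x k))"
      using e[OF k] \<epsilon>_le_norm_grad[OF k] by linarith
    note * = short_step_successful[OF params step_conditions(2,3,5,1)[OF k] \<epsilon>_le_norm_grad[OF k]
        \<open>e > 0\<close> this K' t _ sm]
    show ?thesis
      using * \<open>c > 0\<close> by simp
  qed
  then show thesis
    using that[of s "max 1 N"] s by simp
qed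

lemma not_convergent_if_\<epsilon>_bounded_below:
  assumes "e > 0" and e: "\<And>k. k \<ge> 1 \<Longrightarrow> e \<le> \<epsilon> k"
  shows "\<not> x \<longlonglongrightarrow> z"
proof
  assume lim: "x \<longlonglongrightarrow> z"
  obtain s N where s: "s > 0" "N \<ge> 1"
    and short: "\<And>k. k \<ge> N \<Longrightarrow> norm (d k) < s \<Longrightarrow>
      rho_hat f \<theta> (x k) (d k) \<ge> \<beta> \<and> \<gamma>\<^sub>2 * r k \<le> norm (d k)"
    by (rule short_steps_near_limit[OF lim \<open>e > 0\<close> e]) (assumption, rule that)
  \<comment> \<open>A radius is cut only after a step of length at least \<open>s\<close>, hence
    from a radius at least \<open>s\<close>, and the result is at least
    \<open>s / \<omega>\<^sub>1\<close>.\<close>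
  define m where "m = min (r N) (s / \<omega>\<^sub>1)"
  have "m > 0"
    using s r_pos[of N] param_bounds by (simp add: m_def)
  have m: "m \<le> r k" if "k \<ge> N" for k
    using that
  proof (induction k rule: dec_induct)
    case (step k)
    then have k: "k \<ge> 1"
      using s by simp
    show ?case
    proof (cases "rho_hat f \<theta> (x k) (d k) \<ge> \<beta>")
      case False
      then have "s \<le> norm (d k)"
        using short[of k] step by force
      then have "s \<le> r k"
        using step_conditions(4)[OF k] by linarith
      then have "s / \<omega>\<^sub>1 \<le> r k / \<omega>\<^sub>1"
        using param_bounds by (simp add: divide_right_mono)
      then show ?thesis
        using False k by (simp add: r_Suc m_def)
    qed (use step k in \<open>simp add: r_Suc\<close>)
  qed (simp add: m_def)
  have "(\<lambda>k. x (Suc k) - x k) \<longlonglongrightarrow> z - z"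
    by (intro tendsto_intros LIMSEQ_Suc lim)
  from tendstoD[OF this, of "min s (\<gamma>\<^sub>2 * m)"]
  have "eventually (\<lambda>k. norm (x (Suc k) - x k) < min s (\<gamma>\<^sub>2 * m)) sequentially"
    using s \<open>m > 0\<close> param_bounds by simp
  then obtain N' where N': "\<And>k. k \<ge> N' \<Longrightarrow> norm (x (Suc k) - x k) < min s (\<gamma>\<^sub>2 * m)"
    by (auto simp: eventually_sequentially)
  define P where "P = max N N'"
  have unsuccessful: "r (Suc k) = r k / \<omega>\<^sub>1" if "k \<ge> P" for k
  proof -
    have k: "k \<ge> 1" "k \<ge> N" "k \<ge> N'"
      using that s by (auto simp: P_def)
    \<comment> \<open>As \<open>\<sigma> \<le> \<beta>\<close>, the step is accepted, so
      \<open>norm (d k)\<close> is the distance of consecutive iterates: short enough for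
      \<open>short\<close>, yet below \<open>\<gamma>\<^sub>2 * r k\<close>.\<close>
    have False if succ: "rho_hat f \<theta> (x k) (d k) \<ge> \<beta>"
    proof -
      have "norm (d k) < min s (\<gamma>\<^sub>2 * m)"
        using N'[of k] k succ param_bounds by (simp add: x_Suc)
      moreover have "\<gamma>\<^sub>2 * m \<le> \<gamma>\<^sub>2 * r k"
        using m[of k] k param_bounds by simp
      ultimately show False
        using short[of k] k by simp
    qed
    then show ?thesis
      using k by (auto simp: r_Suc)
  qed
  \<comment> \<open>Geometric decay of the radii contradicts their lower bound
    \<open>m\<close>.\<close>
  have "r (P + j) = r P * (1 / \<omega>\<^sub>1) ^ j" for j
    by (induction j) (simp_all add: unsuccessful)
  moreover have "(\<lambda>j. r P * (1 / \<omega>\<^sub>1) ^ j) \<longlonglongrightarrow> 0"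
    using param_bounds by (intro tendsto_mult_right_zero LIMSEQ_power_zero) auto
  ultimately have "(\<lambda>j. r (P + j)) \<longlonglongrightarrow> 0"
    by simp
  then have "m \<le> 0"
    by (rule LIMSEQ_le_const) (auto intro!: m simp: P_def)
  then show False
    using \<open>m > 0\<close> by simp
qed

theorem \<epsilon>_tendsto_0_or_unbounded:
  "\<epsilon> \<longlonglongrightarrow> 0 \<or> filterlim (\<lambda>k. f (x k)) at_bot sequentially"
proof (rule disjCI)
  assume "\<not> filterlim (\<lambda>k. f (x k)) at_bot sequentially"
  \<comment> \<open>The values exceed \<open>B\<close> infinitely often, and by monotonicity always.
    The shift by \<open>Suc\<close> skips the unconstrained index 0.\<close>
  then obtain B where "\<not> eventually (\<lambda>k. f (x k) \<le> B) sequentially"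
    by (auto simp: filterlim_at_bot)
  moreover have dec: "decseq (\<lambda>k. f (x (Suc k)))"
    by (intro decseq_SucI f_Suc_le) simp
  ultimately have B: "B \<le> f (x (Suc k))" for k
  proof -
    obtain n where "n \<ge> Suc k" "B < f (x n)"
      using \<open>\<not> eventually _ _\<close> by (auto simp: eventually_sequentially not_le)
    moreover then obtain n' where "n = Suc n'" "k \<le> n'"
      by (cases n) auto
    ultimately show ?thesis
      using decseqD[OF dec, of k n'] by simp
  qed
  have "decseq (\<lambda>k. \<epsilon> (Suc k))"
    by (intro decseq_SucI \<epsilon>_Suc_le) simp
  moreover have "0 \<le> \<epsilon> (Suc k)" for k
    by (simp add: \<epsilon>_nonneg)
  ultimately obtain e where lim: "(\<lambda>k. \<epsilon> (Suc k)) \<longlonglongrightarrow> e" and "\<And>k. e \<le> \<epsilon> (Suc k)"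
    using decseq_convergent by metis
  then have e: "e \<le> \<epsilon> k" if "k \<ge> 1" for k
    using that by (cases k) auto
  have "e \<ge> 0"
    using lim by (rule LIMSEQ_le_const) (simp add: \<epsilon>_nonneg)
  have "\<not> e > 0"
  \<comment> \<open>A positive limit \<open>e\<close> would bound every \<open>\<epsilon> k\<close>
    from below, so the iterates would converge, which was excluded.\<close>
  proof
    assume "e > 0"
    let ?C = "2 / (\<sigma> * \<theta> * e)"
    have "convergent (\<lambda>k. x (Suc k))"
    proof (rule convergent_of_telescoping_bound)
      show "norm (x (Suc (Suc k)) - x (Suc k)) \<le> ?C * f (x (Suc k)) - ?C * f (x (Suc (Suc k)))" for k
        using norm_x_diff_le[OF _ \<open>e > 0\<close> e] by simp
      show "?C * B \<le> ?C * f (x (Suc k))" for k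
        using B \<open>e > 0\<close> \<sigma>_pos param_bounds by (intro mult_left_mono) auto
    qed
    then show False
      using not_convergent_if_\<epsilon>_bounded_below[OF \<open>e > 0\<close> e]
      by (auto simp: convergent_def filterlim_sequentially_Suc[of x])
  qed
  with \<open>e \<ge> 0\<close> lim show "\<epsilon> \<longlonglongrightarrow> 0"
    by (simp add: filterlim_sequentially_Suc)
qed

end

theorem theorem2:
  fixes f :: "real ^ 'n \<Rightarrow> real"
    and \<theta> \<beta> \<sigma> \<omega>\<^sub>1 \<omega>\<^sub>2 \<gamma>\<^sub>1 \<gamma>\<^sub>2 \<gamma>\<^sub>3 \<xi> :: real
    and b :: "nat \<Rightarrow> ereal"
    and x d :: "nat \<Rightarrow> real ^ 'n"
    and \<delta> r \<epsilon> :: "nat \<Rightarrow> real"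
  assumes "twice_differentiable f"
    and "CAT_params \<theta> \<beta> \<sigma> \<omega>\<^sub>1 \<omega>\<^sub>2 \<gamma>\<^sub>1 \<gamma>\<^sub>2 \<gamma>\<^sub>3 \<xi>"
    and "CAT_run f \<theta> \<beta> \<sigma> \<omega>\<^sub>1 \<omega>\<^sub>2 \<gamma>\<^sub>1 \<gamma>\<^sub>2 \<gamma>\<^sub>3 \<xi> b x d \<delta> r \<epsilon>"
    and "locally_lipschitz_hess f"
    and "\<sigma> > 0"
  shows "\<epsilon> \<longlonglongrightarrow> 0 \<or> filterlim (\<lambda>k. f (x k)) at_bot sequentially"
proof -
  interpret cat_run f \<theta> \<beta> \<sigma> \<omega>\<^sub>1 \<omega>\<^sub>2 \<gamma>\<^sub>1 \<gamma>\<^sub>2 \<gamma>\<^sub>3 \<xi> b x d \<delta> r \<epsilon>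
    using assms by unfold_locales
  show ?thesis
    by (fact \<epsilon>_tendsto_0_or_unbounded)
qed

end
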